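(* Let $\alpha\in\mathbb{R}$ and let $(v,f,p)$ be a $C^2$-solution with parameter $\alpha$. (i) If $\alpha\le2$ and $H=0$ identically on $\mathbb{S}^2$, then the solution is irrotational, i.e. $\Omega=\nabla\times V=0$ in $\mathbb{R}^3\setminus\{0\}$. (ii) If $\alpha=0$ and $H$ is constant on $\mathbb{S}^2$, then the solution is irrotational.
   Context: $\mathbb{S}^2$ is the unit sphere in $\mathbb{R}^3$ with outward unit normal $\vec n$. A $C^k$-solution with parameter $\alpha$ is a triple $(v,f,p)$, where $v$ is a tangent vector field and $f,p$ are functions on $\mathbb{S}^2$, all of class $C^k$ ($k\ge1$), such that $$V(x)=\frac{v+f\vec n}{|x|^{\alpha}},\qquad P(x)=\frac{p}{|x|^{2\alpha}}$$ ($v,f,p,\vec n$ evaluated at $x/|x|$) solve $V\cdot\nabla V+\nabla P=0$, $\operatorname{div}V=0$ in $\mathbb{R}^3\setminus\{0\}$. Equivalently, on $\mathbb{S}^2$, $$(2-\alpha)f+\operatorname{div}v=0,\quad v\nabla f=|v|^2+\alpha f^2+2\alpha p,\quad (1-\alpha)fv+v\nabla v=-\nabla p,$$ where $v\nabla f=\langle v,\nabla f\rangle$ and $v\nabla v$ is the covariant derivative. The Bernoulli function is $H=|v|^2+f^2+2p:\mathbb{S}^2\to\mathbb{R}$. *)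

theory Defs
  imports "HOL-Analysis.Analysis"
begin

primrec Ck_on ::
  "nat \<Rightarrow> ('a::euclidean_space \<Rightarrow> 'b::real_normed_vector) \<Rightarrow> 'a set \<Rightarrow> bool" where
  "Ck_on 0 g U \<longleftrightarrow> continuous_on U g"
| "Ck_on (Suc k) g U \<longleftrightarrow>
     (\<forall>x\<in>U. g differentiable (at x)) \<and>
     (\<forall>b\<in>Basis. Ck_on k (\<lambda>x. frechet_derivative g (at x) b) U)"

text \<open>Regularity on a non-open set such as the sphere, in the usual sense for functions on a
  submanifold: local extendability to a function of class C^k on an open set of the ambient space.\<close>

definition Ck_on_set ::
  "nat \<Rightarrow> ('a::euclidean_space \<Rightarrow> 'b::real_normed_vector) \<Rightarrow> 'a set \<Rightarrow> bool" where
  "Ck_on_set k g S \<longleftrightarrow>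
     (\<forall>x\<in>S. \<exists>U h. open U \<and> x \<in> U \<and> Ck_on k h U \<and> (\<forall>y\<in>S \<inter> U. h y = g y))"

abbreviation S2 :: "(real^3) set" where
  "S2 \<equiv> sphere 0 1"

definition partial :: "3 \<Rightarrow> (real^3 \<Rightarrow> 'b::real_normed_vector) \<Rightarrow> real^3 \<Rightarrow> 'b" where
  "partial i g x = frechet_derivative g (at x) (axis i 1)"

definition gradient :: "(real^3 \<Rightarrow> real) \<Rightarrow> real^3 \<Rightarrow> real^3" where
  "gradient g x = (\<chi> i. partial i g x)"

definition divergence :: "(real^3 \<Rightarrow> real^3) \<Rightarrow> real^3 \<Rightarrow> real" where
  "divergence W x = (\<Sum>i\<in>UNIV. partial i W x $ i)"

definition curl :: "(real^3 \<Rightarrow> real^3) \<Rightarrow> real^3 \<Rightarrow> real^3" where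
  "curl W x = vector
     [partial 2 W x $ 3 - partial 3 W x $ 2,
      partial 3 W x $ 1 - partial 1 W x $ 3,
      partial 1 W x $ 2 - partial 2 W x $ 1]"

definition convective :: "(real^3 \<Rightarrow> real^3) \<Rightarrow> (real^3 \<Rightarrow> real^3) \<Rightarrow> real^3 \<Rightarrow> real^3" where
  "convective W Z x = (\<Sum>i\<in>UNIV. (W x $ i) *\<^sub>R partial i Z x)"

text \<open>The data \<open>v\<close>, \<open>f\<close>, \<open>p\<close> are total functions of which only the values on the sphere matter.
  There the outward unit normal at \<open>x\<close> is \<open>x\<close> itself; below, \<open>sgn x\<close> is \<open>x / |x|\<close>.\<close>

definition hom_velocity ::
  "real \<Rightarrow> (real^3 \<Rightarrow> real^3) \<Rightarrow> (real^3 \<Rightarrow> real) \<Rightarrow> real^3 \<Rightarrow> real^3" where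
  "hom_velocity \<alpha> v f x = (v (sgn x) + f (sgn x) *\<^sub>R sgn x) /\<^sub>R (norm x powr \<alpha>)"

definition hom_pressure :: "real \<Rightarrow> (real^3 \<Rightarrow> real) \<Rightarrow> real^3 \<Rightarrow> real" where
  "hom_pressure \<alpha> p x = p (sgn x) / norm x powr (2 * \<alpha>)"

definition Ck_solution ::
  "nat \<Rightarrow> real \<Rightarrow> (real^3 \<Rightarrow> real^3) \<Rightarrow> (real^3 \<Rightarrow> real) \<Rightarrow> (real^3 \<Rightarrow> real) \<Rightarrow> bool" where
  "Ck_solution k \<alpha> v f p \<longleftrightarrow>
     1 \<le> k \<and> (\<forall>x\<in>S2. v x \<bullet> x = 0) \<and>
     Ck_on_set k v S2 \<and> Ck_on_set k f S2 \<and> Ck_on_set k p S2 \<and>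
     (\<forall>x. x \<noteq> 0 \<longrightarrow>
        convective (hom_velocity \<alpha> v f) (hom_velocity \<alpha> v f) x
          + gradient (hom_pressure \<alpha> p) x = 0 \<and>
        divergence (hom_velocity \<alpha> v f) x = 0)"

definition bernoulli ::
  "(real^3 \<Rightarrow> real^3) \<Rightarrow> (real^3 \<Rightarrow> real) \<Rightarrow> (real^3 \<Rightarrow> real) \<Rightarrow> real^3 \<Rightarrow> real" where
  "bernoulli v f p x = (norm (v x))\<^sup>2 + (f x)\<^sup>2 + 2 * p x"

definition irrotational :: "(real^3 \<Rightarrow> real^3) \<Rightarrow> bool" where
  "irrotational V \<longleftrightarrow> (\<forall>x. x \<noteq> 0 \<longrightarrow> curl V x = 0)"

end

theory Submission
  imports Defs
begin

text \<open>Constancy of \<open>|V|\<^sup>2 + 2 P\<close> turns the Euler equation into \<open>\<Omega> \<times> V = 0\<close>. Put \<open>F = x \<bullet> V\<close>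
  (\<open>rad\<close> below) and \<open>W = x \<bullet> \<Omega>\<close> (\<open>rad_curl\<close>). Homogeneity gives \<open>\<nabla>F = (1 - \<alpha>) V + x \<times> \<Omega>\<close>, parallelism gives \<open>F \<Omega> = W V\<close>, and the
  divergence of the latter gives \<open>V \<bullet> \<nabla>W = (1 - \<alpha>) \<Omega> \<bullet> V\<close>. The key claim is \<open>F W = 0\<close>.
  For \<open>\<alpha> \<le> 1\<close> it follows at the extrema of a suitable multiple of \<open>W\<^sup>2 F\<close> on the sphere. For
  \<open>1 < \<alpha> \<le> 2\<close> let \<open>T\<close> be the part of \<open>V\<close> tangential to the spheres; integrating
  \<open>div (F T) = (1 - \<alpha>) |T|\<^sup>2 - (2 - \<alpha>) F\<^sup>2 / |x|\<^sup>2\<close> yields \<open>T = 0\<close>, and a radial \<open>V\<close> has \<open>F W = 0\<close>.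
  Finally, on an open set where \<open>\<Omega>\<close> has no zero, \<open>F W = 0\<close> forces \<open>F = 0\<close>, then \<open>\<nabla>F = 0\<close> forces
  \<open>V = 0\<close>, which contradicts \<open>\<Omega> \<noteq> 0\<close>.\<close>

section \<open>Functions of class \<open>C\<^sup>k\<close>\<close>

lemma Ck_on_cong:
  assumes "open U" "\<And>x. x \<in> U \<Longrightarrow> f x = g x" "Ck_on k f U"
  shows "Ck_on k g U"
  using assms(2,3)
proof (induction k arbitrary: f g)
  case 0
  then show ?case using continuous_on_cong by fastforce
next
  case (Suc k)
  have "g differentiable (at x)" if "x \<in> U" for x
    using Suc.prems that assms(1)
    by (metis Ck_on.simps(2) differentiable_def has_derivative_transform_within_open)
  moreover have "Ck_on k (\<lambda>x. frechet_derivative g (at x) b) U" if "b \<in> Basis" for b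
  proof (rule Suc.IH)
    show "frechet_derivative f (at x) b = frechet_derivative g (at x) b" if "x \<in> U" for x
      using Suc.prems that assms(1)
      by (metis Ck_on.simps(2) frechet_derivative_transform_within_open)
    show "Ck_on k (\<lambda>x. frechet_derivative f (at x) b) U"
      using Suc.prems that by simp
  qed
  ultimately show ?case by simp
qed

lemma Ck_on_subset: "Ck_on k g U \<Longrightarrow> W \<subseteq> U \<Longrightarrow> Ck_on k g W"
  by (induction k arbitrary: g) (auto intro: continuous_on_subset)

text \<open>This allows patching: it serves data on the sphere, which extend only locally, and a
  field that is cut off to zero near the origin.\<close>

lemma Ck_on_local:
  assumes "\<And>x. x \<in> U \<Longrightarrow> \<exists>N. open N \<and> x \<in> N \<and> Ck_on k g N"
  shows "Ck_on k g U"
  using assms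
proof (induction k arbitrary: g)
  case 0
  have "isCont g x" if "x \<in> U" for x
    using 0[OF that] by (auto simp: continuous_on_eq_continuous_at)
  then show ?case by (simp add: continuous_at_imp_continuous_on)
next
  case (Suc k)
  have "g differentiable (at x)" if "x \<in> U" for x
    using Suc.prems[OF that] by auto
  moreover have "Ck_on k (\<lambda>x. frechet_derivative g (at x) b) U" if "b \<in> Basis" for b
    using Suc.prems that by (intro Suc.IH) fastforce
  ultimately show ?case by simp
qed

text \<open>Derivatives at a point are unique, so an explicit formula \<open>g'\<close> may replace
  \<open>frechet_derivative\<close> in the recursion; agreement on an open set carries over to all
  further derivatives.\<close>

lemma Ck_on_SucI:
  assumes "open U" "\<And>x. x \<in> U \<Longrightarrow> (g has_derivative g' x) (at x)"
    and "\<And>b. b \<in> Basis \<Longrightarrow> Ck_on k (\<lambda>x. g' x b) U"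
  shows "Ck_on (Suc k) g U"
proof -
  have "Ck_on k (\<lambda>x. frechet_derivative g (at x) b) U" if "b \<in> Basis" for b
    using assms(1) _ assms(3)[OF that]
    by (rule Ck_on_cong) (use assms(2) frechet_derivative_at in metis)
  then show ?thesis using assms(2) by (auto simp: differentiable_def)
qed

lemma Ck_on_has_derivative:
  "Ck_on (Suc k) g U \<Longrightarrow> x \<in> U \<Longrightarrow> (g has_derivative frechet_derivative g (at x)) (at x)"
  using frechet_derivative_works by auto

lemma Ck_on_SucD: "Ck_on (Suc k) g U \<Longrightarrow> Ck_on k g U"
proof (induction k arbitrary: g)
  case 0
  then show ?case
    by (auto intro!: continuous_at_imp_continuous_on differentiable_imp_continuous_within)
next
  case (Suc k)
  then show ?case by (metis Ck_on.simps(2))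
qed

lemma Ck_on_imp_continuous_on: "Ck_on k g U \<Longrightarrow> continuous_on U g"
  by (induction k) (use Ck_on_SucD in auto)

lemma Ck_on_const: "open U \<Longrightarrow> Ck_on k (\<lambda>x. c) U"
proof (induction k arbitrary: c)
  case (Suc k)
  then show ?case by (intro Ck_on_SucI[where g' = "\<lambda>x h. 0"]) auto
qed simp

lemma Ck_on_bounded_linear:
  assumes "bounded_linear L" "open U"
  shows "Ck_on k L U"
proof (cases k)
  case 0
  then show ?thesis using assms linear_continuous_on by auto
next
  case (Suc j)
  show ?thesis unfolding Suc
    by (rule Ck_on_SucI[where g' = "\<lambda>x. L"])
      (use assms in \<open>auto intro: Ck_on_const bounded_linear_imp_has_derivative\<close>)
qed

lemma Ck_on_add:
  assumes "open U" "Ck_on k f U" "Ck_on k g U"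
  shows "Ck_on k (\<lambda>x. f x + g x) U"
  using assms(2,3)
proof (induction k arbitrary: f g)
  case 0
  then show ?case by (auto intro: continuous_on_add)
next
  case (Suc k)
  show ?case
    by (rule Ck_on_SucI[OF assms(1)], rule has_derivative_add[OF Ck_on_has_derivative Ck_on_has_derivative])
      (use Suc in auto)
qed

lemma Ck_on_sum:
  assumes "open U" "\<And>i. i \<in> I \<Longrightarrow> Ck_on k (f i) U"
  shows "Ck_on k (\<lambda>x. \<Sum>i\<in>I. f i x) U"
  using assms(2)
  by (induction I rule: infinite_finite_induct) (auto intro!: Ck_on_const Ck_on_add assms(1))

lemma Ck_on_bilinear:
  assumes "bounded_bilinear B" "open U" "Ck_on k f U" "Ck_on k g U"
  shows "Ck_on k (\<lambda>x. B (f x) (g x)) U"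
  using assms(3,4)
proof (induction k arbitrary: f g)
  case 0
  then show ?case using assms(1) by (auto intro: bounded_bilinear.continuous_on)
next
  case (Suc k)
  show ?case
  proof (rule Ck_on_SucI[OF assms(2)])
    show "((\<lambda>x. B (f x) (g x)) has_derivative
        (\<lambda>h. B (f x) (frechet_derivative g (at x) h) + B (frechet_derivative f (at x) h) (g x))) (at x)"
      if "x \<in> U" for x
      by (rule bounded_bilinear.FDERIV[OF assms(1)]) (use Suc.prems that Ck_on_has_derivative in blast)+
    show "Ck_on k (\<lambda>x. B (f x) (frechet_derivative g (at x) b) +
        B (frechet_derivative f (at x) b) (g x)) U" if "b \<in> Basis" for b
      using Suc.prems[THEN Ck_on_SucD] Suc.prems that by (intro Ck_on_add assms(2) Suc.IH) auto
  qed
qed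

lemmas Ck_on_scaleR = Ck_on_bilinear[OF bounded_bilinear_scaleR]
  and Ck_on_mult = Ck_on_bilinear[OF bounded_bilinear_mult]
  and Ck_on_inner = Ck_on_bilinear[OF bounded_bilinear_inner]

lemma Ck_on_compose:
  fixes s :: "'a::euclidean_space \<Rightarrow> 'b::euclidean_space"
    and h :: "'b \<Rightarrow> 'c::real_normed_vector"
  assumes "open U" "open W" "Ck_on k h W" "Ck_on k s U" "s ` U \<subseteq> W"
  shows "Ck_on k (\<lambda>x. h (s x)) U"
  using assms(3,4)
proof (induction k arbitrary: h)
  case 0
  then show ?case using assms(5) by (auto intro: continuous_on_compose2)
next
  case (Suc k)
  show ?case
  proof (rule Ck_on_SucI[OF assms(1)])
    fix x assume x: "x \<in> U"
    let ?h' = "frechet_derivative h (at (s x))" and ?s' = "frechet_derivative s (at x)"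
    have h': "(h has_derivative ?h') (at (s x))"
      using Suc.prems x assms(5) by (intro Ck_on_has_derivative) auto
    have "((\<lambda>x. h (s x)) has_derivative (\<lambda>b. ?h' (?s' b))) (at x)"
      using diff_chain_at[OF Ck_on_has_derivative[OF Suc.prems(2) x] h'] by (simp add: o_def)
    \<comment> \<open>Expanding \<open>?s' b\<close> in the basis separates the point from the
      direction: each summand is a product of a coordinate of \<open>?s' b\<close> and a partial
      derivative of \<open>h\<close> composed with \<open>s\<close>, to which the induction
      hypothesis applies.\<close>
    also have "(\<lambda>b. ?h' (?s' b)) = (\<lambda>b. \<Sum>j\<in>Basis. (?s' b \<bullet> j) *\<^sub>R ?h' j)"
    proof
      fix b
      show "?h' (?s' b) = (\<Sum>j\<in>Basis. (?s' b \<bullet> j) *\<^sub>R ?h' j)"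
        using linear_sum[OF has_derivative_linear[OF h'], of "\<lambda>j. (?s' b \<bullet> j) *\<^sub>R j" Basis]
          linear_scale[OF has_derivative_linear[OF h']]
        by (simp add: euclidean_representation)
    qed
    finally show "((\<lambda>x. h (s x)) has_derivative
        (\<lambda>b. \<Sum>j\<in>Basis. (?s' b \<bullet> j) *\<^sub>R ?h' j)) (at x)" .
  next
    fix b :: 'a assume "b \<in> Basis"
    then show "Ck_on k (\<lambda>x. \<Sum>j\<in>Basis.
        (frechet_derivative s (at x) b \<bullet> j) *\<^sub>R frechet_derivative h (at (s x)) j) U"
      using Suc.prems Ck_on_SucD[OF Suc.prems(2)]
      by (intro Ck_on_sum Ck_on_scaleR Ck_on_inner Ck_on_const Suc.IH assms(1)) auto
  qed
qed

section \<open>Powers of the norm, radial projection, and homogeneous extensions from the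
  sphere\<close>

lemma has_derivative_norm_powr:
  fixes x :: "'a::euclidean_space"
  assumes "x \<noteq> 0"
  shows "((\<lambda>x. norm x powr a) has_derivative (\<lambda>h. a * norm x powr (a - 2) * (x \<bullet> h))) (at x)"
proof -
  have "((\<lambda>x. norm x powr a) has_derivative
      (\<lambda>h. norm x powr a * (0 * ln (norm x) + (h \<bullet> sgn x) * a / norm x))) (at x)"
    using assms by (intro has_derivative_powr has_derivative_norm) auto
  moreover have "norm x powr a * (0 * ln (norm x) + (h \<bullet> sgn x) * a / norm x) =
      a * norm x powr (a - 2) * (x \<bullet> h)" for h
    using assms by (simp add: sgn_div_norm powr_diff inner_commute field_simps power2_eq_square)
  ultimately show ?thesis by simp
qed

text \<open>The induction runs over all exponents at once, because differentiation replaces the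
  exponent \<open>a\<close> by \<open>a - 2\<close> and adds a linear factor.\<close>

lemma Ck_on_norm_powr: "Ck_on k (\<lambda>x::'a::euclidean_space. norm x powr a) (- {0})"
proof (induction k arbitrary: a)
  case 0
  then show ?case by (auto intro!: continuous_intros)
next
  case (Suc k)
  show ?case
    by (rule Ck_on_SucI[OF _ has_derivative_norm_powr])
      (auto intro!: Ck_on_mult Ck_on_inner Suc Ck_on_const
        Ck_on_bounded_linear[OF bounded_linear_ident])
qed

lemma Ck_on_sgn: "Ck_on k (sgn :: 'a::euclidean_space \<Rightarrow> 'a) (- {0})"
proof (rule Ck_on_cong)
  show "Ck_on k (\<lambda>x::'a. norm x powr -1 *\<^sub>R x) (- {0})"
    by (rule Ck_on_scaleR[OF _ Ck_on_norm_powr Ck_on_bounded_linear[OF bounded_linear_ident]]) auto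
qed (auto simp: sgn_div_norm powr_minus)

text \<open>Near a given point \<open>sgn\<close> takes values in the domain of one ambient
  extension \<open>h\<close> of \<open>g\<close>. There \<open>g\<close> after \<open>sgn\<close>
  equals \<open>h\<close> after \<open>sgn\<close>, a composition of maps on open sets.\<close>

lemma Ck_on_sgn_compose:
  fixes g :: "'a::euclidean_space \<Rightarrow> 'b::real_normed_vector"
  assumes "Ck_on_set k g (sphere 0 1)"
  shows "Ck_on k (\<lambda>x. g (sgn x)) (- {0})"
proof (rule Ck_on_local)
  fix x :: 'a assume "x \<in> - {0}"
  then have "sgn x \<in> sphere 0 1" by (simp add: norm_sgn)
  from bspec[OF assms[unfolded Ck_on_set_def] this] obtain U h where
    U: "open U" "sgn x \<in> U" "Ck_on k h U" "\<forall>y\<in>sphere 0 1 \<inter> U. h y = g y"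
    by (elim exE conjE)
  define N where "N = (- {0}) \<inter> sgn -` U"
  have "open N" unfolding N_def
    using Ck_on_imp_continuous_on[OF Ck_on_sgn] U(1) by (intro continuous_open_preimage) auto
  moreover have "Ck_on k (\<lambda>x. h (sgn x)) N"
    by (rule Ck_on_compose[OF \<open>open N\<close> U(1,3) Ck_on_subset[OF Ck_on_sgn]]) (auto simp: N_def)
  then have "Ck_on k (\<lambda>x. g (sgn x)) N"
    by (rule Ck_on_cong[rotated 2]) (use U(4) \<open>open N\<close> in \<open>auto simp: N_def norm_sgn\<close>)
  ultimately show "\<exists>N. open N \<and> x \<in> N \<and> Ck_on k (\<lambda>x. g (sgn x)) N"
    using \<open>x \<in> - {0}\<close> U(2) by (auto simp: N_def)
qed

lemma Ck_on_hom_velocity: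
  assumes "Ck_on_set k v S2" "Ck_on_set k f S2"
  shows "Ck_on k (hom_velocity \<alpha> v f) (- {0})"
proof (rule Ck_on_cong)
  show "Ck_on k (\<lambda>x. norm x powr - \<alpha> *\<^sub>R (v (sgn x) + f (sgn x) *\<^sub>R sgn x)) (- {0})"
    using assms
    by (intro Ck_on_scaleR[OF _ Ck_on_norm_powr Ck_on_add[OF _ Ck_on_sgn_compose
            Ck_on_scaleR[OF _ Ck_on_sgn_compose Ck_on_sgn]]]) auto
qed (auto simp: hom_velocity_def powr_minus)

section \<open>Mixed derivatives and integrals of derivatives\<close>

text \<open>Two applications of the mean value theorem: first in the direction \<open>a\<close> to
  the increment \<open>\<psi>\<close> of \<open>u\<close> across the parallelogram, then in the
  direction \<open>b\<close> to the derivative along \<open>a\<close>.\<close>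

lemma mixed_difference_eq:
  fixes u :: "'a::euclidean_space \<Rightarrow> real"
  assumes h: "0 < h"
    and u: "\<And>s t. \<lbrakk>0 \<le> s; s \<le> h; 0 \<le> t; t \<le> h\<rbrakk> \<Longrightarrow>
      (u has_derivative u' (x + s *\<^sub>R a + t *\<^sub>R b)) (at (x + s *\<^sub>R a + t *\<^sub>R b))"
    and ua: "\<And>s t. \<lbrakk>0 \<le> s; s \<le> h; 0 \<le> t; t \<le> h\<rbrakk> \<Longrightarrow>
      ((\<lambda>y. u' y a) has_derivative ua (x + s *\<^sub>R a + t *\<^sub>R b)) (at (x + s *\<^sub>R a + t *\<^sub>R b))"
  obtains s t where "0 \<le> s" "s \<le> h" "0 \<le> t" "t \<le> h"
    "u (x + h *\<^sub>R a + h *\<^sub>R b) - u (x + h *\<^sub>R a) - u (x + h *\<^sub>R b) + u x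
       = h * h * ua (x + s *\<^sub>R a + t *\<^sub>R b) b"
proof -
  define \<psi> where "\<psi> s = u (x + s *\<^sub>R a + h *\<^sub>R b) - u (x + s *\<^sub>R a)" for s
  have line: "((\<lambda>s. u (x + s *\<^sub>R a + t *\<^sub>R b)) has_derivative
      (\<lambda>k. k * u' (x + s *\<^sub>R a + t *\<^sub>R b) a)) (at s within S)"
    if "0 \<le> s" "s \<le> h" "0 \<le> t" "t \<le> h" for s t S
  proof -
    have "((\<lambda>s. u (x + s *\<^sub>R a + t *\<^sub>R b)) has_derivative
      (\<lambda>k. u' (x + s *\<^sub>R a + t *\<^sub>R b) (k *\<^sub>R a))) (at s within S)"
      by (rule has_derivative_compose[of "\<lambda>s. x + s *\<^sub>R a + t *\<^sub>R b", OF _ u[OF that]]) (auto intro!: derivative_eq_intros)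
    then show ?thesis
      using linear_scale[OF has_derivative_linear[OF u[OF that]]] by simp
  qed
  have "\<exists>s\<in>{0<..<h}. \<psi> h - \<psi> 0 =
      (h - 0) * u' (x + s *\<^sub>R a + h *\<^sub>R b) a - (h - 0) * u' (x + s *\<^sub>R a + 0 *\<^sub>R b) a"
    unfolding \<psi>_def
    by (rule mvt_simple[OF h])
      (use line[of _ h] line[of _ 0] h in \<open>auto intro!: has_derivative_diff\<close>)
  then obtain s where s: "0 < s" "s < h" and
    eq: "\<psi> h - \<psi> 0 = h * (u' (x + s *\<^sub>R a + h *\<^sub>R b) a - u' (x + s *\<^sub>R a + 0 *\<^sub>R b) a)"
    by (auto simp: algebra_simps)
  have "((\<lambda>t. u' (x + s *\<^sub>R a + t *\<^sub>R b) a) has_derivative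
      (\<lambda>k. k * ua (x + s *\<^sub>R a + t *\<^sub>R b) b)) (at t within {0..h})"
    if "0 \<le> t" "t \<le> h" for t
  proof -
    have s': "0 \<le> s" "s \<le> h" using s by auto
    have "((\<lambda>t. u' (x + s *\<^sub>R a + t *\<^sub>R b) a) has_derivative
        (\<lambda>k. ua (x + s *\<^sub>R a + t *\<^sub>R b) (k *\<^sub>R b))) (at t within {0..h})"
      by (rule has_derivative_compose[of "\<lambda>t. x + s *\<^sub>R a + t *\<^sub>R b", OF _ ua[OF s' that]]) (auto intro!: derivative_eq_intros)
    then show ?thesis
      using linear_scale[OF has_derivative_linear[OF ua[OF s' that]]] by simp
  qed
  then have "\<exists>t\<in>{0<..<h}. u' (x + s *\<^sub>R a + h *\<^sub>R b) a - u' (x + s *\<^sub>R a + 0 *\<^sub>R b) a =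
      (h - 0) * ua (x + s *\<^sub>R a + t *\<^sub>R b) b"
    by (intro mvt_simple[OF h]) auto
  then obtain t where "0 < t" "t < h" "u' (x + s *\<^sub>R a + h *\<^sub>R b) a - u' (x + s *\<^sub>R a + 0 *\<^sub>R b) a =
      h * ua (x + s *\<^sub>R a + t *\<^sub>R b) b"
    by auto
  with s eq show thesis
    by (intro that[of s t]) (auto simp: \<psi>_def algebra_simps)
qed

text \<open>The second difference over a small parallelogram is symmetric in \<open>a\<close> and
  \<open>b\<close>. It thus equals \<open>h * h\<close> times a value of either mixed derivative at
  nearby points, and continuity makes the two values at \<open>x\<close> agree.\<close>

lemma second_derivative_symmetric:
  fixes u :: "'a::euclidean_space \<Rightarrow> real"
  assumes U: "open U" "x \<in> U"
    and u: "\<And>y. y \<in> U \<Longrightarrow> (u has_derivative u' y) (at y)"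
    and ua: "\<And>y. y \<in> U \<Longrightarrow> ((\<lambda>y. u' y a) has_derivative ua y) (at y)"
    and ub: "\<And>y. y \<in> U \<Longrightarrow> ((\<lambda>y. u' y b) has_derivative ub y) (at y)"
    and cont: "continuous_on U (\<lambda>y. ua y b)" "continuous_on U (\<lambda>y. ub y a)"
  shows "ua x b = ub x a"
proof (rule ccontr)
  assume "ua x b \<noteq> ub x a"
  define e where "e = dist (ua x b) (ub x a) / 2"
  have "e > 0" using \<open>ua x b \<noteq> ub x a\<close> by (simp add: e_def)
  have "isCont (\<lambda>y. ua y b) x" "isCont (\<lambda>y. ub y a) x"
    using cont U by (auto simp: continuous_on_eq_continuous_at)
  then have "\<forall>\<^sub>F y in nhds x. dist (ua y b) (ua x b) < e" "\<forall>\<^sub>F y in nhds x. dist (ub y a) (ub x a) < e"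
    using \<open>e > 0\<close> tendsto_at_iff_tendsto_nhds[of "\<lambda>y. ua y b" x]
      tendsto_at_iff_tendsto_nhds[of "\<lambda>y. ub y a" x]
    by (simp_all add: isCont_def tendstoD)
  moreover have "\<forall>\<^sub>F y in nhds x. y \<in> U" using U by (rule eventually_nhds_in_open)
  ultimately have "\<forall>\<^sub>F y in nhds x. dist (ua y b) (ua x b) < e \<and> dist (ub y a) (ub x a) < e \<and> y \<in> U"
    by (intro eventually_conj)
  then obtain d where d: "d > 0" and
    near: "\<And>y. dist y x < d \<Longrightarrow> dist (ua y b) (ua x b) < e \<and> dist (ub y a) (ub x a) < e \<and> y \<in> U"
    unfolding eventually_nhds_metric by blast
  \<comment> \<open>With this size the whole parallelogram stays within distance \<open>d\<close> of
    \<open>x\<close>; the summand 1 keeps the denominator positive and the bound strict.\<close>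
  define h where "h = d / (norm a + norm b + 1)"
  have pos: "norm a + norm b + 1 > 0" by (smt (verit) norm_ge_zero)
  then have h: "h > 0" using d by (simp add: h_def)
  have close: "dist (x + s *\<^sub>R a + t *\<^sub>R b) x < d"
    if "0 \<le> s" "s \<le> h" "0 \<le> t" "t \<le> h" for s t
  proof -
    have "dist (x + s *\<^sub>R a + t *\<^sub>R b) x \<le> norm (s *\<^sub>R a) + norm (t *\<^sub>R b)"
      using norm_triangle_ineq[of "s *\<^sub>R a" "t *\<^sub>R b"] by (simp add: dist_norm algebra_simps)
    also have "\<dots> \<le> h * norm a + h * norm b"
      using that by (auto intro!: add_mono mult_right_mono)
    also have "\<dots> < h * (norm a + norm b + 1)" using h by (simp add: algebra_simps)
    also have "\<dots> = d" using pos by (simp add: h_def)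
    finally show ?thesis .
  qed
  obtain s t where st: "0 \<le> s" "s \<le> h" "0 \<le> t" "t \<le> h" and
    1: "u (x + h *\<^sub>R a + h *\<^sub>R b) - u (x + h *\<^sub>R a) - u (x + h *\<^sub>R b) + u x
       = h * h * ua (x + s *\<^sub>R a + t *\<^sub>R b) b"
    by (rule mixed_difference_eq[of h u u' x a b ua]) (use h u ua near close in auto)
  have close': "dist (x + s *\<^sub>R b + t *\<^sub>R a) x < d"
    if "0 \<le> s" "s \<le> h" "0 \<le> t" "t \<le> h" for s t
    using close[OF that(3,4,1,2)] by (simp add: add_ac)
  obtain s' t' where st': "0 \<le> s'" "s' \<le> h" "0 \<le> t'" "t' \<le> h" and
    2: "u (x + h *\<^sub>R b + h *\<^sub>R a) - u (x + h *\<^sub>R b) - u (x + h *\<^sub>R a) + u x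
       = h * h * ub (x + s' *\<^sub>R b + t' *\<^sub>R a) a"
    by (rule mixed_difference_eq[of h u u' x b a ub]) (use h u ub near close' in auto)
  have "h * h * ua (x + s *\<^sub>R a + t *\<^sub>R b) b = h * h * ub (x + s' *\<^sub>R b + t' *\<^sub>R a) a"
    using 1 2 unfolding add.assoc add.commute[of "h *\<^sub>R b"] by linarith
  then have "ua (x + s *\<^sub>R a + t *\<^sub>R b) b = ub (x + s' *\<^sub>R b + t' *\<^sub>R a) a" using h by simp
  moreover have "dist (ua (x + s *\<^sub>R a + t *\<^sub>R b) b) (ua x b) < e"
    "dist (ub (x + s' *\<^sub>R b + t' *\<^sub>R a) a) (ub x a) < e"
    using near[OF close[OF st]] near[OF close'[OF st']] by auto
  ultimately show False unfolding e_def using dist_triangle_half_r less_irrefl by metis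
qed

text \<open>The integral of the translate of \<open>u\<close> by \<open>t *\<^sub>R e\<close> does
  not depend on \<open>t\<close>; differentiating under the integral at \<open>t = 0\<close> gives
  the claim. The margin \<open>norm e\<close> in the box keeps the support inside for
  \<open>t\<close> between -1 and 1.\<close>

lemma integral_directional_derivative_eq_0:
  fixes u :: "'a::euclidean_space \<Rightarrow> real"
  assumes u: "\<And>x. (u has_derivative u' x) (at x)"
    and cont: "continuous_on UNIV (\<lambda>x. u' x e)"
    and supp: "\<And>x. norm x \<ge> R \<Longrightarrow> u x = 0"
    and box: "cball 0 (R + norm e) \<subseteq> cbox a b"
  shows "integral (cbox a b) (\<lambda>x. u' x e) = 0"
proof -
  have cu: "continuous_on S u" for S
    using has_derivative_continuous[OF u] continuous_at_imp_continuous_on by blast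
  have const: "integral (cbox a b) (\<lambda>x. u (t *\<^sub>R e + x)) = integral UNIV u"
    if "t \<in> {-1..1}" for t
  proof -
    have "integral (cbox a b) (\<lambda>x. u (t *\<^sub>R e + x)) = integral (cbox (a + t *\<^sub>R e) (b + t *\<^sub>R e)) u"
      using integral_shift_cbox_plus[of a b u "t *\<^sub>R e"] by (simp add: o_def)
    also have "\<dots> = integral UNIV (\<lambda>x. if x \<in> cbox (a + t *\<^sub>R e) (b + t *\<^sub>R e) then u x else 0)"
      by (simp add: integral_restrict_UNIV)
    also have "(\<lambda>x. if x \<in> cbox (a + t *\<^sub>R e) (b + t *\<^sub>R e) then u x else 0) = u"
    proof
      fix x
      have "x \<in> cbox (a + t *\<^sub>R e) (b + t *\<^sub>R e)" if "norm x < R"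
      proof -
        have "norm (x - t *\<^sub>R e) \<le> norm x + \<bar>t\<bar> * norm e"
          using norm_triangle_ineq4[of x "t *\<^sub>R e"] by simp
        also have "\<dots> \<le> R + norm e"
          using \<open>t \<in> {-1..1}\<close> that mult_right_mono[of "\<bar>t\<bar>" 1 "norm e"] by (auto simp: abs_le_iff)
        finally have "x - t *\<^sub>R e \<in> cbox a b" using box by (auto simp: dist_norm)
        then show ?thesis by (auto simp: mem_box algebra_simps)
      qed
      then show "(if x \<in> cbox (a + t *\<^sub>R e) (b + t *\<^sub>R e) then u x else 0) = u x"
        using supp[of x] by force
    qed
    finally show ?thesis .
  qed
  have "((\<lambda>t. integral (cbox a b) (\<lambda>x. u (t *\<^sub>R e + x))) has_vector_derivative
      integral (cbox a b) (\<lambda>x. u' (0 *\<^sub>R e + x) e)) (at 0 within {-1..1})"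
  proof (rule leibniz_rule_vector_derivative)
    show "((\<lambda>t. u (t *\<^sub>R e + x)) has_vector_derivative u' (t *\<^sub>R e + x) e) (at t within {-1..1})"
      for t x
    proof -
      have "((\<lambda>t. u (t *\<^sub>R e + x)) has_derivative (\<lambda>k. u' (t *\<^sub>R e + x) (k *\<^sub>R e))) (at t within {-1..1})"
        by (rule has_derivative_compose[of "\<lambda>t. t *\<^sub>R e + x", OF _ u]) (auto intro!: derivative_eq_intros)
      then show ?thesis
        using linear_scale[OF has_derivative_linear[OF u]] by (simp add: has_vector_derivative_def)
    qed
    show "(\<lambda>x. u (t *\<^sub>R e + x)) integrable_on cbox a b" for t
      by (intro integrable_continuous continuous_on_compose2[OF cu]) (auto intro!: continuous_intros)
    have "continuous_on ({-1..1} \<times> cbox a b) (\<lambda>z. u' (fst z *\<^sub>R e + snd z) e)"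
      by (rule continuous_on_compose2[OF cont]) (auto intro!: continuous_intros)
    then show "continuous_on ({-1..1} \<times> cbox a b) (\<lambda>(t, x). u' (t *\<^sub>R e + x) e)"
      by (simp add: case_prod_beta)
  qed auto
  then have "((\<lambda>t. integral UNIV u) has_vector_derivative
      integral (cbox a b) (\<lambda>x. u' (0 *\<^sub>R e + x) e)) (at 0 within {-1..1})"
    by (rule has_vector_derivative_transform[rotated 2]) (use const in auto)
  moreover have "((\<lambda>t. integral UNIV u) has_vector_derivative 0) (at (0::real) within {-1..1})"
    by simp
  ultimately have "integral (cbox a b) (\<lambda>x. u' (0 *\<^sub>R e + x) e) = 0"
    by (intro vector_derivative_unique_within_closed_interval[of "-1" 1 0]) auto
  then show ?thesis by simp
qed

section \<open>Vector calculus in three dimensions\<close>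

unbundle cross3_syntax

lemma partial_has_derivative:
  assumes "(W has_derivative W') (at x)"
  shows "partial i W x = W' (axis i 1)"
  using frechet_derivative_at[OF assms] by (simp add: partial_def)

lemma frechet_derivative_eq_sum_partial:
  assumes "W differentiable (at x)"
  shows "frechet_derivative W (at x) h = (\<Sum>i\<in>UNIV. (h $ i) *\<^sub>R partial i W x)"
proof -
  have lin: "linear (frechet_derivative W (at x))"
    using assms by (rule linear_frechet_derivative)
  have "frechet_derivative W (at x) (\<Sum>i\<in>UNIV. (h $ i) *\<^sub>R axis i 1) =
      (\<Sum>i\<in>UNIV. (h $ i) *\<^sub>R partial i W x)"
    unfolding linear_sum[OF lin] linear_scale[OF lin] partial_def ..
  then show ?thesis using basis_expansion[of h] by (simp add: scalar_mult_eq_scaleR)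
qed

lemma convective_eq:
  "Z differentiable (at x) \<Longrightarrow> convective W Z x = frechet_derivative Z (at x) (W x)"
  by (simp add: convective_def frechet_derivative_eq_sum_partial)

lemma gradient_inner:
  "g differentiable (at x) \<Longrightarrow> gradient g x \<bullet> h = frechet_derivative g (at x) h"
  by (simp add: gradient_def frechet_derivative_eq_sum_partial inner_vec_def mult.commute)

text \<open>In this form smoothness and scaling of the curl follow from linearity, without a case
  split on components.\<close>

lemma curl_eq_sum_cross: "curl W x = (\<Sum>i\<in>UNIV. axis i 1 \<times> partial i W x)"
  unfolding curl_def by (simp add: cross3_simps axis_def forall_3)

text \<open>The antisymmetric part of the Jacobian acts as the cross product with the curl. This
  yields both the gradient of \<open>x \<bullet> V x\<close> and the passage from the Euler equation
  to \<open>curl V x \<times> V x = 0\<close>.\<close>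

lemma curl_antisymmetric:
  assumes "W differentiable (at x)"
  shows "frechet_derivative W (at x) h \<bullet> k - frechet_derivative W (at x) k \<bullet> h = (curl W x \<times> h) \<bullet> k"
  unfolding frechet_derivative_eq_sum_partial[OF assms] curl_def
  by (simp add: cross3_simps)

lemma divergence_has_derivative:
  "(W has_derivative W') (at x) \<Longrightarrow> divergence W x = (\<Sum>i\<in>UNIV. W' (axis i 1) $ i)"
  by (simp add: divergence_def partial_has_derivative)

text \<open>Product rule for the divergence; the term \<open>g' (W x)\<close> is the derivative of
  \<open>g\<close> along \<open>W\<close>.\<close>

lemma divergence_scaleR:
  assumes g: "(g has_derivative g') (at x)" and W: "W differentiable (at x)"
  shows "divergence (\<lambda>y. g y *\<^sub>R W y) x = g' (W x) + g x * divergence W x"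
proof -
  have "g' (W x) = (\<Sum>i\<in>UNIV. W x $ i * g' (axis i 1))"
    using frechet_derivative_eq_sum_partial[OF differentiableI[OF g], of "W x"]
    by (simp add: partial_has_derivative[OF g] frechet_derivative_at[OF g, symmetric])
  with W[unfolded frechet_derivative_works] show ?thesis
    by (subst divergence_has_derivative[OF has_derivative_scaleR[OF g]])
      (auto simp: divergence_def partial_def sum.distrib sum_distrib_left mult.commute)
qed

lemma divergence_diff:
  assumes "Y differentiable (at x)" "Z differentiable (at x)"
  shows "divergence (\<lambda>y. Y y - Z y) x = divergence Y x - divergence Z x"
  using assms[unfolded frechet_derivative_works]
  by (subst divergence_has_derivative[OF has_derivative_diff])
    (auto simp: divergence_def partial_def sum_subtractf)

lemma divergence_ident: "divergence (\<lambda>x. x) x = 3"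
  by (subst divergence_has_derivative[OF has_derivative_ident]) (simp add: axis_def)

lemma divergence_cong:
  "open N \<Longrightarrow> x \<in> N \<Longrightarrow> W differentiable (at x) \<Longrightarrow> (\<And>y. y \<in> N \<Longrightarrow> W y = Z y) \<Longrightarrow>
    divergence W x = divergence Z x"
  using frechet_derivative_transform_within_open[of W x N Z] unfolding divergence_def partial_def by simp

lemma axis_in_Basis_real: "axis i (1::real) \<in> Basis"
  by (simp add: axis_in_Basis_iff)

lemma Ck_on_cross:
  "open U \<Longrightarrow> Ck_on k f U \<Longrightarrow> Ck_on k g U \<Longrightarrow> Ck_on k (\<lambda>x. f x \<times> g x) U"
  by (rule Ck_on_bilinear[OF bilinear_cross[unfolded bilinear_conv_bounded_bilinear]])

lemma Ck_on_partial: "Ck_on (Suc k) W U \<Longrightarrow> Ck_on k (partial i W) U"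
  unfolding partial_def[abs_def] by (simp add: axis_in_Basis_real)

lemma Ck_on_curl:
  assumes "open U" "Ck_on (Suc k) W U"
  shows "Ck_on k (curl W) U"
proof -
  have "Ck_on k (\<lambda>x. \<Sum>i\<in>UNIV. axis i 1 \<times> partial i W x) U"
    by (intro Ck_on_sum Ck_on_cross Ck_on_const Ck_on_partial assms)
  then show ?thesis by (simp add: curl_eq_sum_cross[abs_def])
qed

lemma partial_commute:
  fixes W :: "real^3 \<Rightarrow> real^'n"
  assumes U: "open U" "x \<in> U" and W: "Ck_on (Suc (Suc 0)) W U"
  shows "partial i (partial j W) x = partial j (partial i W) x"
proof -
  have "partial i (partial j W) x $ k = partial j (partial i W) x $ k" for k
  proof -
    have P: "Ck_on (Suc 0) (partial l W) U" for l using W by (rule Ck_on_partial)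
    have "continuous_on U (partial l (partial m W))" for l m
      using Ck_on_partial[OF P] by simp
    then have cont: "continuous_on U (\<lambda>y. frechet_derivative (partial m W) (at y) (axis l 1) $ k)" for l m
      by (intro continuous_on_component) (simp add: partial_def[abs_def])
    have *: "((\<lambda>y. frechet_derivative W (at y) (axis l 1) $ k) has_derivative
        (\<lambda>h. frechet_derivative (partial l W) (at y) h $ k)) (at y)" if "y \<in> U" for l y
      using bounded_linear.has_derivative[OF bounded_linear_vec_nth, OF Ck_on_has_derivative[OF P that]] by (simp add: partial_def)
    have "frechet_derivative (partial j W) (at x) (axis i 1) $ k =
        frechet_derivative (partial i W) (at x) (axis j 1) $ k"
      by (rule second_derivative_symmetric[OF U, of "\<lambda>y. W y $ k"
            "\<lambda>y h. frechet_derivative W (at y) h $ k"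
            "axis j 1" "\<lambda>y h. frechet_derivative (partial j W) (at y) h $ k"
            "axis i 1" "\<lambda>y h. frechet_derivative (partial i W) (at y) h $ k"])
        (use * cont bounded_linear.has_derivative[OF bounded_linear_vec_nth Ck_on_has_derivative[OF W]] in auto)
    then show ?thesis by (simp add: partial_def)
  qed
  then show ?thesis by (simp add: vec_eq_iff)
qed

lemma divergence_curl:
  assumes U: "open U" "x \<in> U" and W: "Ck_on (Suc (Suc 0)) W U"
  shows "divergence (curl W) x = 0"
proof -
  have diff: "partial j W differentiable (at x)" for j
    using Ck_on_partial[OF W] U by simp
  have "((\<lambda>y. axis j 1 \<times> partial j W y) has_derivative
      (\<lambda>h. axis j 1 \<times> frechet_derivative (partial j W) (at x) h)) (at x)" for j
    by (rule bounded_linear.has_derivative[OF bounded_bilinear.bounded_linear_right[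
          OF bilinear_cross[unfolded bilinear_conv_bounded_bilinear]]])
      (rule diff[unfolded frechet_derivative_works])
  then have "(curl W has_derivative
      (\<lambda>h. \<Sum>j\<in>UNIV. axis j 1 \<times> frechet_derivative (partial j W) (at x) h)) (at x)"
    unfolding curl_eq_sum_cross[abs_def] by (intro has_derivative_sum) simp
  from divergence_has_derivative[OF this] have "divergence (curl W) x =
      (\<Sum>i\<in>UNIV. (\<Sum>j\<in>UNIV. axis j 1 \<times> partial i (partial j W) x) $ i)"
    by (simp add: partial_def)
  also have "\<dots> = 0"
    by (simp add: sum_3 cross_components axis_def partial_commute[OF assms, of 2 1]
        partial_commute[OF assms, of 3 1] partial_commute[OF assms, of 3 2])
  finally show ?thesis .
qed

section \<open>Homogeneous Beltrami fields\<close>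

lemma homogeneous_euler:
  fixes g :: "'a::real_normed_vector \<Rightarrow> 'b::real_normed_vector"
  assumes hom: "\<And>t. 0 < t \<Longrightarrow> g (t *\<^sub>R x) = t powr d *\<^sub>R g x"
    and g: "(g has_derivative g') (at x)"
  shows "g' x = d *\<^sub>R g x"
proof -
  \<comment> \<open>The restriction of \<open>g\<close> to the ray through \<open>x\<close> is
    differentiated at \<open>t = 1\<close> twice: by the chain rule and by homogeneity.\<close>
  have "((\<lambda>t. g (t *\<^sub>R x)) has_derivative (\<lambda>k. g' (k *\<^sub>R x))) (at (1::real))"
    by (rule has_derivative_compose[of "\<lambda>t. t *\<^sub>R x" "\<lambda>k. k *\<^sub>R x" 1 UNIV g g'])
      (use g in \<open>auto intro!: derivative_eq_intros\<close>)
  then have "((\<lambda>t. t powr d *\<^sub>R g x) has_derivative (\<lambda>k. g' (k *\<^sub>R x))) (at (1::real))"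
    by (rule has_derivative_transform_within_open[of _ _ _ _ "{0<..}"]) (use hom in auto)
  moreover have "((\<lambda>t. t powr d *\<^sub>R g x) has_derivative (\<lambda>k. (k * d) *\<^sub>R g x)) (at (1::real))"
    by (auto intro!: derivative_eq_intros)
  ultimately have "(\<lambda>k. g' (k *\<^sub>R x)) = (\<lambda>k. (k * d) *\<^sub>R g x)"
    by (rule has_derivative_unique)
  from fun_cong[OF this, of 1] show ?thesis by simp
qed

text \<open>Near \<open>t *\<^sub>R x\<close> the function \<open>g\<close> is the rescaled copy
  \<open>t powr d *\<^sub>R g (inverse t *\<^sub>R y)\<close>; the inner scaling costs one power of
  \<open>t\<close>.\<close>

lemma homogeneous_frechet_derivative:
  fixes g :: "'a::real_normed_vector \<Rightarrow> 'b::real_normed_vector"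
  assumes hom: "\<And>y s. y \<noteq> 0 \<Longrightarrow> 0 < s \<Longrightarrow> g (s *\<^sub>R y) = s powr d *\<^sub>R g y"
    and g: "(g has_derivative g') (at x)" and "x \<noteq> 0" "0 < t"
  shows "(g has_derivative (\<lambda>h. t powr (d - 1) *\<^sub>R g' h)) (at (t *\<^sub>R x))"
proof -
  have "((\<lambda>y. g (inverse t *\<^sub>R y)) has_derivative (\<lambda>h. g' (inverse t *\<^sub>R h))) (at (t *\<^sub>R x))"
    by (rule has_derivative_compose[of "\<lambda>y. inverse t *\<^sub>R y" "\<lambda>h. inverse t *\<^sub>R h" "t *\<^sub>R x" UNIV g g'])
      (use g \<open>0 < t\<close> in \<open>auto intro!: derivative_eq_intros\<close>)
  then have "((\<lambda>y. t powr d *\<^sub>R g (inverse t *\<^sub>R y)) has_derivative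
      (\<lambda>h. t powr d *\<^sub>R g' (inverse t *\<^sub>R h))) (at (t *\<^sub>R x))"
    by (rule has_derivative_scaleR_right)
  moreover have "t powr d *\<^sub>R g' (inverse t *\<^sub>R h) = t powr (d - 1) *\<^sub>R g' h" for h
    using linear_scale[OF has_derivative_linear[OF g]] \<open>0 < t\<close>
    by (simp add: powr_diff divide_inverse)
  ultimately have "((\<lambda>y. t powr d *\<^sub>R g (inverse t *\<^sub>R y)) has_derivative
      (\<lambda>h. t powr (d - 1) *\<^sub>R g' h)) (at (t *\<^sub>R x))" by simp
  then show ?thesis
  proof (rule has_derivative_transform_within_open)
    show "t powr d *\<^sub>R g (inverse t *\<^sub>R y) = g y" if "y \<in> - {0}" for y
      using hom[of "inverse t *\<^sub>R y" t] that \<open>0 < t\<close> by simp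
  qed (use \<open>x \<noteq> 0\<close> \<open>0 < t\<close> in auto)
qed

text \<open>Every term of the divergence integrates to zero over a large box. A continuous function
  of one sign with zero integral vanishes.\<close>

lemma compactly_supported_divergence_nonpos:
  fixes Y :: "real^3 \<Rightarrow> real^3"
  assumes Y: "Ck_on (Suc 0) Y UNIV" and supp: "\<And>x. norm x \<ge> R \<Longrightarrow> Y x = 0"
    and nonpos: "\<And>x. divergence Y x \<le> 0"
  shows "divergence Y x = 0"
proof -
  obtain b :: "real^3" where b: "cball 0 (max R (norm x) + 1) \<subseteq> cbox (- b) b"
    \<comment> \<open>The box contains the point \<open>x\<close> as well as the support, with
      margin 1 for the length of a coordinate vector.\<close>
    using bounded_subset_cbox_symmetric[OF bounded_cball] by blast
  have cont: "continuous_on S (\<lambda>x. frechet_derivative Y (at x) (axis i 1) $ i)" for S i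
    by (rule continuous_on_component, rule continuous_on_subset[OF _ subset_UNIV])
      (use Y in \<open>simp add: axis_in_Basis_real\<close>)
  have "((\<lambda>x. \<Sum>i\<in>UNIV. frechet_derivative Y (at x) (axis i 1) $ i) has_integral
      (\<Sum>i\<in>(UNIV :: 3 set). 0)) (cbox (- b) b)"
  proof (intro has_integral_sum)
    fix i :: 3
    have "integral (cbox (- b) b) (\<lambda>x. frechet_derivative Y (at x) (axis i 1) $ i) = 0"
    proof (rule integral_directional_derivative_eq_0[where u = "\<lambda>x. Y x $ i" and R = R
          and u' = "\<lambda>x h. frechet_derivative Y (at x) h $ i"])
      show "((\<lambda>x. Y x $ i) has_derivative (\<lambda>h. frechet_derivative Y (at x) h $ i)) (at x)" for x
        by (rule bounded_linear.has_derivative[OF bounded_linear_vec_nth Ck_on_has_derivative[OF Y UNIV_I]])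
      show "cball 0 (R + norm (axis i (1::real))) \<subseteq> cbox (- b) b"
        using b by (auto simp: subset_iff)
    qed (use cont supp in auto)
    moreover have "(\<lambda>x. frechet_derivative Y (at x) (axis i 1) $ i) integrable_on cbox (- b) b"
      by (intro integrable_continuous cont)
    ultimately show "((\<lambda>x. frechet_derivative Y (at x) (axis i 1) $ i) has_integral 0) (cbox (- b) b)"
      by (simp add: has_integral_iff)
  qed simp
  then have int: "((\<lambda>x. - divergence Y x) has_integral 0) (cbox (- b) b)"
    using has_integral_neg[of _ 0] by (simp add: divergence_def partial_def)
  have "continuous_on (cbox (- b) b) (\<lambda>x. - divergence Y x)"
    unfolding divergence_def partial_def by (intro continuous_intros cont)
  \<comment> \<open>The box must have nonempty interior: in a degenerate box every integral is
    zero.\<close>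
  moreover have "0 \<in> box (- b) b"
  proof -
    have "ball 0 1 \<subseteq> cbox (- b) b"
      using b by (rule order_trans[rotated]) (auto intro: order_trans[OF less_imp_le] simp: le_max_iff_disj add_increasing)
    then have "ball 0 1 \<subseteq> interior (cbox (- b) b)" by (intro interior_maximal) auto
    then show ?thesis by (auto simp: interior_cbox)
  qed
  moreover have "x \<in> cbox (- b) b" using b by (auto simp: subset_iff)
  ultimately have "- divergence Y x = 0"
    using int nonpos by (intro has_integral_0_cbox_imp_0[of "- b" b]) auto
  then show ?thesis by simp
qed

text \<open>The pressure has been eliminated here: the Euler equation survives only as parallelism
  of velocity and vorticity.\<close>

locale homogeneous_beltrami_field =
  fixes \<alpha> :: real and V :: "real^3 \<Rightarrow> real^3"
  assumes C2: "Ck_on (Suc (Suc 0)) V (- {0})"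
    and homogeneous: "x \<noteq> 0 \<Longrightarrow> 0 < t \<Longrightarrow> V (t *\<^sub>R x) = t powr - \<alpha> *\<^sub>R V x"
    and divergence_free: "x \<noteq> 0 \<Longrightarrow> divergence V x = 0"
    and beltrami: "x \<noteq> 0 \<Longrightarrow> curl V x \<times> V x = 0"
begin

definition rad :: "real^3 \<Rightarrow> real" where "rad x = x \<bullet> V x"

definition rad_curl :: "real^3 \<Rightarrow> real" where "rad_curl x = x \<bullet> curl V x"

lemma open_punctured: "open (- {0 :: real^3})"
  by (simp add: open_Compl)

lemma differentiable: "x \<noteq> 0 \<Longrightarrow> V differentiable (at x)"
  using C2 by simp

lemma C1: "Ck_on (Suc 0) V (- {0})"
  using C2 by (rule Ck_on_SucD)

lemma C1_curl: "Ck_on (Suc 0) (curl V) (- {0})"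
  by (rule Ck_on_curl[OF open_punctured C2])

lemma C1_rad: "Ck_on (Suc 0) rad (- {0})"
  unfolding rad_def[abs_def]
  by (rule Ck_on_inner[OF open_punctured Ck_on_bounded_linear[OF bounded_linear_ident open_punctured] C1])

lemma C1_rad_curl: "Ck_on (Suc 0) rad_curl (- {0})"
  unfolding rad_curl_def[abs_def]
  by (rule Ck_on_inner[OF open_punctured Ck_on_bounded_linear[OF bounded_linear_ident open_punctured] C1_curl])

lemma rad_homogeneous: "x \<noteq> 0 \<Longrightarrow> 0 < t \<Longrightarrow> rad (t *\<^sub>R x) = t powr (1 - \<alpha>) *\<^sub>R rad x"
  by (simp add: rad_def homogeneous powr_diff powr_minus divide_inverse)

lemma curl_homogeneous:
  assumes "x \<noteq> 0" "0 < t"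
  shows "curl V (t *\<^sub>R x) = t powr (- \<alpha> - 1) *\<^sub>R curl V x"
proof -
  have "partial i V (t *\<^sub>R x) = t powr (- \<alpha> - 1) *\<^sub>R partial i V x" for i
    using partial_has_derivative[OF homogeneous_frechet_derivative[OF homogeneous
          Ck_on_has_derivative[OF C1] assms]] assms
    by (simp add: partial_def)
  then show ?thesis by (simp add: curl_eq_sum_cross cross_mult_right scaleR_sum_right)
qed

lemma rad_curl_homogeneous:
  assumes "x \<noteq> 0" "0 < t"
  shows "rad_curl (t *\<^sub>R x) = t powr - \<alpha> *\<^sub>R rad_curl x"
  using assms by (simp add: rad_curl_def curl_homogeneous powr_diff)

text \<open>In \<open>x \<bullet> DV h + h \<bullet> V\<close>, the identity
  \<open>curl_antisymmetric\<close> exchanges \<open>x\<close> and \<open>h\<close> at the cost of a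
  curl term, and Euler's relation gives \<open>DV x = - \<alpha> *\<^sub>R V x\<close>.\<close>

lemma rad_has_derivative:
  assumes "x \<noteq> 0"
  shows "(rad has_derivative (\<lambda>h. ((1 - \<alpha>) *\<^sub>R V x + x \<times> curl V x) \<bullet> h)) (at x)"
proof -
  let ?D = "frechet_derivative V (at x)"
  have D: "(V has_derivative ?D) (at x)"
    using Ck_on_has_derivative[OF C1] assms by simp
  have "(rad has_derivative (\<lambda>h. x \<bullet> ?D h + h \<bullet> V x)) (at x)"
    unfolding rad_def[abs_def] by (rule has_derivative_inner[OF has_derivative_ident D])
  moreover have "x \<bullet> ?D h + h \<bullet> V x = ((1 - \<alpha>) *\<^sub>R V x + x \<times> curl V x) \<bullet> h" for h
  proof -
    have "?D h \<bullet> x = ?D x \<bullet> h + (curl V x \<times> h) \<bullet> x"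
      using curl_antisymmetric[OF differentiable[OF assms], of h x] by simp
    moreover have "?D x = - \<alpha> *\<^sub>R V x"
      using homogeneous_euler[OF homogeneous[OF assms] D] .
    ultimately show ?thesis
      using cross_triple[of x "curl V x" h] by (simp add: algebra_simps inner_commute)
  qed
  ultimately show ?thesis by simp
qed

lemma grad_rad_inner_V:
  assumes "x \<noteq> 0"
  shows "((1 - \<alpha>) *\<^sub>R V x + x \<times> curl V x) \<bullet> V x = (1 - \<alpha>) * (V x \<bullet> V x)"
  using cross_triple[of x "curl V x" "V x"] beltrami[OF assms] by (simp add: algebra_simps)

text \<open>This is the expansion of the triple product of \<open>x\<close> with
  \<open>curl V x \<times> V x\<close>, which is zero.\<close>

lemma rad_scaleR_curl:
  assumes "x \<noteq> 0"
  shows "rad x *\<^sub>R curl V x = rad_curl x *\<^sub>R V x"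
  using Lagrange[of x "curl V x" "V x"] beltrami[OF assms] by (simp add: rad_def rad_curl_def)

text \<open>Take the divergence of both sides of \<open>rad_scaleR_curl\<close>. Both
  \<open>V\<close> and its curl are divergence free, so only derivatives of the scalar factors
  remain, and \<open>x \<times> curl V x\<close> is orthogonal to the curl.\<close>

lemma rad_curl_derivative_V:
  assumes "x \<noteq> 0" and D: "(rad_curl has_derivative D) (at x)"
  shows "D (V x) = (1 - \<alpha>) * (curl V x \<bullet> V x)"
proof -
  have curl: "curl V differentiable (at x)"
    using C1_curl assms(1) by simp
  have "divergence (\<lambda>y. rad_curl y *\<^sub>R V y) x = divergence (\<lambda>y. rad y *\<^sub>R curl V y) x"
    using has_derivative_scaleR[OF rad_has_derivative[OF assms(1)] curl[unfolded frechet_derivative_works]]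
    by (intro divergence_cong[OF open_punctured, symmetric])
      (auto simp: differentiable_def assms(1) rad_scaleR_curl)
  moreover have "divergence (\<lambda>y. rad_curl y *\<^sub>R V y) x = D (V x)"
    using divergence_scaleR[OF D differentiable[OF assms(1)]] divergence_free[OF assms(1)] by simp
  moreover have "divergence (\<lambda>y. rad y *\<^sub>R curl V y) x = (1 - \<alpha>) * (curl V x \<bullet> V x)"
    using divergence_scaleR[OF rad_has_derivative[OF assms(1)] curl]
      divergence_curl[OF open_punctured _ C2] assms(1)
    by (simp add: inner_add_left dot_cross_self inner_commute[of "V x"])
  ultimately show ?thesis by simp
qed

text \<open>For \<open>\<alpha> \<le> 1\<close> the function \<open>rad_curl\<^sup>2 rad |x|\<^bsup>3\<alpha>-1\<^esup>\<close> is homogeneous of degree 0, and on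
  the unit sphere its derivative along \<open>V\<close> is
  \<open>rad_curl\<^sup>2 (3 (1 - \<alpha>) (|V|\<^sup>2 - rad\<^sup>2) + 2 rad\<^sup>2)\<close>; so it vanishes where it is extremal.\<close>

lemma rad_curl_rad_eq_0_le_1:
  assumes "\<alpha> \<le> 1" "x \<noteq> 0"
  shows "rad_curl x * rad x = 0"
proof -
  \<comment> \<open>The factors \<open>rad_curl\<close>, \<open>rad_curl\<close>, \<open>rad\<close>
    have total degree \<open>1 - 3 * \<alpha>\<close>, which the power of the norm cancels.\<close>
  define G where "G y = rad_curl y * rad_curl y * (rad y * norm y powr (3 * \<alpha> - 1))" for y
  have G_hom: "G (t *\<^sub>R y) = G y" if "y \<noteq> 0" "0 < t" for y t
  proof -
    have "t powr - \<alpha> * (t powr - \<alpha> * (t powr (1 - \<alpha>) * t powr (3 * \<alpha> - 1))) = 1"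
      using that by (simp flip: powr_add)
    then show ?thesis
      using that
      by (simp add: G_def rad_homogeneous rad_curl_homogeneous powr_mult)
  qed
  then have G_sgn: "G (sgn y) = G y" if "y \<noteq> 0" for y
    using that by (simp add: sgn_div_norm)
  have critical: "G y = 0" if y: "y \<in> S2" and ext: "(\<forall>z\<in>S2. G z \<le> G y) \<or> (\<forall>z\<in>S2. G y \<le> G z)" for y
  proof -
    have y0: "y \<noteq> 0" and ny: "norm y = 1" using y by auto
    obtain D where D: "(rad_curl has_derivative D) (at y)"
      using C1_rad_curl y0 by (auto simp: differentiable_def)
    have der: "(G has_derivative
      (\<lambda>h. rad_curl y * rad_curl y * (rad y * ((3 * \<alpha> - 1) * norm y powr (3 * \<alpha> - 1 - 2) * (y \<bullet> h)) +
          ((1 - \<alpha>) *\<^sub>R V y + y \<times> curl V y) \<bullet> h * norm y powr (3 * \<alpha> - 1)) +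
        (rad_curl y * D h + D h * rad_curl y) * (rad y * norm y powr (3 * \<alpha> - 1)))) (at y)"
      unfolding G_def[abs_def]
      by (intro has_derivative_mult D rad_has_derivative has_derivative_norm_powr y0)
    \<comment> \<open>Degree 0 turns an extremum on the sphere into one on the open punctured space,
      so the full derivative vanishes there, in particular along \<open>V y\<close>.\<close>
    have "(\<forall>z\<in>- {0}. G z \<le> G y) \<or> (\<forall>z\<in>- {0}. G y \<le> G z)"
    proof -
      have "\<exists>w\<in>S2. G z = G w" if "z \<in> - {0}" for z
        using that G_sgn[of z] by (intro bexI[of _ "sgn z"]) (simp_all add: norm_sgn)
      then show ?thesis by (rule_tac disj_forward[OF ext]) metis+
    qed
    from fun_cong[OF differential_zero_maxmin[OF _ open_punctured der this], of "V y"] y0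
    have "rad_curl y * rad_curl y * (rad y * ((3 * \<alpha> - 1) * (y \<bullet> V y)) +
          ((1 - \<alpha>) *\<^sub>R V y + y \<times> curl V y) \<bullet> V y) +
        (rad_curl y * D (V y) + D (V y) * rad_curl y) * rad y = 0"
      by (simp add: ny)
    then have "rad_curl y * rad_curl y * ((3 * \<alpha> - 1) * rad y * rad y + (1 - \<alpha>) * (V y \<bullet> V y)) +
        2 * (1 - \<alpha>) * rad_curl y * (rad y *\<^sub>R curl V y \<bullet> V y) = 0"
      unfolding grad_rad_inner_V[OF y0] rad_curl_derivative_V[OF y0 D]
      by (simp add: rad_def[symmetric]) (simp add: algebra_simps)
    \<comment> \<open>Replacing \<open>rad y *\<^sub>R curl V y\<close> by
      \<open>rad_curl y *\<^sub>R V y\<close> produces a common factor; the other factor is a sum of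
      two nonnegative terms.\<close>
    then have "(rad_curl y)\<^sup>2 * (3 * (1 - \<alpha>) * (V y \<bullet> V y - (rad y)\<^sup>2) + 2 * (rad y)\<^sup>2) = 0"
      unfolding rad_scaleR_curl[OF y0] by (simp add: algebra_simps power2_eq_square)
    moreover have "(rad y)\<^sup>2 \<le> V y \<bullet> V y"
      using Cauchy_Schwarz_ineq[of y "V y"] ny by (simp add: rad_def dot_square_norm)
    ultimately have "rad_curl y = 0 \<or> rad y = 0"
      using \<open>\<alpha> \<le> 1\<close> by (auto simp: add_nonneg_eq_0_iff)
    then show ?thesis by (auto simp: G_def)
  qed
  have "continuous_on S2 G"
    unfolding G_def[abs_def]
    by (intro continuous_intros continuous_on_subset[OF Ck_on_imp_continuous_on[OF C1_rad]]
        continuous_on_subset[OF Ck_on_imp_continuous_on[OF C1_rad_curl]]) auto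
  moreover have "S2 \<noteq> {}" by simp
  ultimately obtain m M where mM: "m \<in> S2" "\<forall>z\<in>S2. G m \<le> G z" "M \<in> S2" "\<forall>z\<in>S2. G z \<le> G M"
    using continuous_attains_inf[OF compact_sphere, of 0 1 G]
      continuous_attains_sup[OF compact_sphere, of 0 1 G] by auto
  \<comment> \<open>Minimum and maximum of \<open>G\<close> are both zero, hence \<open>G\<close>
    vanishes on the sphere.\<close>
  then have "G m = 0" "G M = 0" using critical by blast+
  moreover have "sgn x \<in> S2" using \<open>x \<noteq> 0\<close> by (simp add: norm_sgn)
  ultimately have "G (sgn x) = 0" using mM(2,4) by (simp add: order_antisym)
  then have "G x = 0" using G_sgn \<open>x \<noteq> 0\<close> by simp
  then show ?thesis using \<open>x \<noteq> 0\<close> by (auto simp: G_def)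
qed

text \<open>The derivative of \<open>rad_curl\<close> along \<open>V x\<close> is
  \<open>- \<alpha> * \<beta> * rad_curl x\<close> by homogeneity and
  \<open>(1 - \<alpha>) * \<beta> * rad_curl x\<close> by \<open>rad_curl_derivative_V\<close>.
  Comparing them leaves \<open>\<beta> * rad_curl x = 0\<close>.\<close>

lemma rad_curl_rad_eq_0_of_parallel:
  assumes "x \<noteq> 0" and V: "V x = \<beta> *\<^sub>R x"
  shows "rad_curl x * rad x = 0"
proof -
  obtain D where D: "(rad_curl has_derivative D) (at x)"
    using C1_rad_curl assms(1) by (auto simp: differentiable_def)
  have "D x = - \<alpha> *\<^sub>R rad_curl x"
    using homogeneous_euler[OF rad_curl_homogeneous[OF assms(1)] D] .
  then have "D (V x) = - \<alpha> * (\<beta> * rad_curl x)"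
    using linear_scale[OF has_derivative_linear[OF D]] by (simp add: V)
  moreover have "curl V x \<bullet> V x = \<beta> * rad_curl x"
    by (simp add: V rad_curl_def inner_commute)
  ultimately have "\<beta> * rad_curl x = 0"
    using rad_curl_derivative_V[OF assms(1) D] by (simp add: algebra_simps)
  then show ?thesis by (auto simp: rad_def V)
qed

text \<open>The projection of \<open>V x\<close> onto the plane orthogonal to \<open>x\<close>. The
  exponent is -2 because \<open>rad x\<close> and the vector \<open>x\<close> each carry a factor
  |x|.\<close>

definition tang :: "real^3 \<Rightarrow> real^3" where
  "tang x = V x - (rad x * norm x powr - 2) *\<^sub>R x"

lemma tang_orthogonal: "x \<noteq> 0 \<Longrightarrow> tang x \<bullet> x = 0"
  by (simp add: tang_def rad_def inner_diff_left inner_commute[of x] dot_square_norm powr_minus)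

lemma C1_rad_tang: "Ck_on (Suc 0) (\<lambda>x. rad x *\<^sub>R tang x) (- {0})"
proof -
  have "Ck_on (Suc 0) (\<lambda>x. V x + (-1) *\<^sub>R (rad x * norm x powr - 2) *\<^sub>R x) (- {0})"
    by (intro Ck_on_add[OF _ C1] Ck_on_bounded_linear[OF bounded_linear_ident]
        Ck_on_scaleR[OF _ Ck_on_const] Ck_on_scaleR[OF _ Ck_on_mult[OF _ C1_rad Ck_on_norm_powr]]
        open_punctured)
  then have "Ck_on (Suc 0) tang (- {0})"
    by (simp only: tang_def[abs_def] scaleR_minus_left scaleR_one) simp
  then show ?thesis by (rule Ck_on_scaleR[OF open_punctured C1_rad])
qed

text \<open>Split the field as \<open>rad y *\<^sub>R V y - c y *\<^sub>R y\<close>. The first part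
  has divergence \<open>(1 - \<alpha>) * (V x \<bullet> V x)\<close>; the second, as
  \<open>c\<close> has degree \<open>- 2 * \<alpha>\<close>, contributes
  \<open>(3 - 2 * \<alpha>) * c x\<close>. Pythagoras for \<open>V x\<close> finishes.\<close>

lemma divergence_rad_tang:
  assumes "x \<noteq> 0"
  shows "divergence (\<lambda>y. rad y *\<^sub>R tang y) x =
    (1 - \<alpha>) * (tang x \<bullet> tang x) - (2 - \<alpha>) * ((rad x)\<^sup>2 * norm x powr - 2)"
proof -
  define c where "c y = rad y * rad y * norm y powr - 2" for y
  obtain D where D: "(c has_derivative D) (at x)"
    unfolding c_def[abs_def]
    using has_derivative_mult[OF has_derivative_mult[OF rad_has_derivative rad_has_derivative]
        has_derivative_norm_powr] assms by blast
  have "c (t *\<^sub>R x) = t powr (- 2 * \<alpha>) *\<^sub>R c x" if "0 < t" for t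
  proof -
    have "t powr (1 - \<alpha>) * (t powr (1 - \<alpha>) * t powr - 2) = t powr (- 2 * \<alpha>)"
      using that by (simp flip: powr_add)
    from this[symmetric] show ?thesis
      using that assms by (simp add: c_def rad_homogeneous powr_mult)
  qed
  from homogeneous_euler[OF this D] have Dx: "D x = - 2 * \<alpha> * c x" by simp
  have "divergence (\<lambda>y. rad y *\<^sub>R tang y) x = divergence (\<lambda>y. rad y *\<^sub>R V y - c y *\<^sub>R y) x"
    by (simp add: tang_def c_def scaleR_diff_right mult.assoc)
  also have "\<dots> = divergence (\<lambda>y. rad y *\<^sub>R V y) x - divergence (\<lambda>y. c y *\<^sub>R y) x"
    using has_derivative_scaleR[OF D has_derivative_ident]
      has_derivative_scaleR[OF rad_has_derivative[OF assms] differentiable[OF assms, unfolded frechet_derivative_works]]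
    by (intro divergence_diff) (auto simp: differentiable_def)
  also have "\<dots> = (1 - \<alpha>) * (V x \<bullet> V x) + 2 * \<alpha> * c x - 3 * c x"
    using divergence_scaleR[OF D differentiable_ident]
      divergence_scaleR[OF rad_has_derivative[OF assms] differentiable[OF assms]]
    by (simp add: grad_rad_inner_V[OF assms] divergence_free[OF assms] divergence_ident Dx)
  also have "V x \<bullet> V x = tang x \<bullet> tang x + c x"
  proof -
    have "V x = tang x + (rad x * norm x powr - 2) *\<^sub>R x" by (simp add: tang_def)
    then have "V x \<bullet> V x = (tang x + (rad x * norm x powr - 2) *\<^sub>R x) \<bullet> (tang x + (rad x * norm x powr - 2) *\<^sub>R x)"
      by simp
    also have "\<dots> = tang x \<bullet> tang x + (rad x * norm x powr - 2)\<^sup>2 * (norm x)\<^sup>2"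
      using tang_orthogonal[OF assms]
      by (simp add: inner_add_left inner_add_right inner_commute[of x "tang x"] dot_square_norm[of x] power2_eq_square[of "rad x * _"])
    also have "(rad x * norm x powr - 2)\<^sup>2 * (norm x)\<^sup>2 = c x"
      using assms by (simp add: c_def powr_minus power2_eq_square field_simps)
    finally show ?thesis .
  qed
  finally show ?thesis by (simp add: c_def algebra_simps power2_eq_square)
qed

text \<open>In this range both terms of \<open>divergence_rad_tang\<close> are nonpositive, so a
  cutoff and integration make them vanish. As \<open>1 - \<alpha>\<close> is nonzero,
  \<open>V\<close> is radial, and the parallel case applies.\<close>

lemma rad_curl_rad_eq_0_gt_1:
  assumes \<alpha>: "1 < \<alpha>" "\<alpha> \<le> 2" and "x \<noteq> 0"
  shows "rad_curl x * rad x = 0"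
proof -
  \<comment> \<open>Since \<open>tang\<close> is tangent to the spheres, the gradient of the radial cutoff \<open>\<phi>\<close> does not
    contribute to the divergence of \<open>\<phi> rad tang\<close>.\<close>
  define q :: "real \<Rightarrow> real" where "q t = (max 0 t)\<^sup>2" for t
  \<comment> \<open>Squaring the positive part removes the kink at 0, so the cutoff is of class
    C^1.\<close>
  have q: "(q has_derivative (\<lambda>h. h * (2 * max 0 t))) (at t)" for t
  proof -
    consider "t > 0" | "t < 0" | "t = 0" by linarith
    then have "(q has_field_derivative 2 * max 0 t) (at t)"
    proof cases
      case 1
      have "((\<lambda>t. t\<^sup>2) has_field_derivative 2 * max 0 t) (at t)"
        using 1 by (auto intro!: derivative_eq_intros)
      then show ?thesis
        by (rule has_field_derivative_transform_within_open[of _ _ _ "{0<..}"]) (use 1 in \<open>auto simp: q_def\<close>)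
    next
      case 2
      have "((\<lambda>t. 0) has_field_derivative 2 * max 0 t) (at t)" using 2 by simp
      then show ?thesis
        by (rule has_field_derivative_transform_within_open[of _ _ _ "{..<0}"]) (use 2 in \<open>auto simp: q_def\<close>)
    next
      case 3
      have "((\<lambda>h. (q (0 + h) - q 0) / h) \<longlongrightarrow> 0) (at 0)"
      proof (rule Lim_null_comparison)
        show "\<forall>\<^sub>F h in at 0. norm ((q (0 + h) - q 0) / h) \<le> \<bar>h\<bar>"
          by (auto simp: q_def max_def power2_eq_square)
        show "((\<lambda>h. \<bar>h\<bar>) \<longlongrightarrow> 0) (at (0::real))" by (rule tendsto_eq_intros refl | simp)+
      qed
      then show ?thesis using 3 by (simp add: DERIV_def)
    qed
    then show ?thesis by (simp add: has_field_derivative_def mult.commute[of _ "2 * max 0 t"])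
  qed
  have "Ck_on (Suc 0) q UNIV"
    by (rule Ck_on_SucI[OF _ q]) (auto intro!: continuous_intros)
  \<comment> \<open>Positive exactly on the shell 1 < |y| < 2, so the cutoff vanishes near the
    origin, where \<open>V\<close> may be singular, and for large |y|.\<close>
  define s :: "real^3 \<Rightarrow> real" where "s y = (y \<bullet> y - 1) * (4 - y \<bullet> y)" for y
  have s: "(s has_derivative (\<lambda>h. 2 * (5 - 2 * (y \<bullet> y)) * (y \<bullet> h))) (at y)" for y
    unfolding s_def[abs_def]
    by (auto intro!: derivative_eq_intros simp: inner_commute algebra_simps)
  have "Ck_on (Suc 0) s UNIV"
    by (rule Ck_on_SucI[OF _ s]) (auto intro!: continuous_intros)
  define \<phi> where "\<phi> y = q (s y)" for y
  have C1_\<phi>: "Ck_on (Suc 0) \<phi> UNIV"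
    unfolding \<phi>_def[abs_def]
    by (rule Ck_on_compose[OF open_UNIV open_UNIV \<open>Ck_on (Suc 0) q UNIV\<close> \<open>Ck_on (Suc 0) s UNIV\<close>]) simp
  have \<phi>_nonneg: "\<phi> y \<ge> 0" for y by (simp add: \<phi>_def q_def)
  have \<phi>: "(\<phi> has_derivative (\<lambda>h. 2 * (5 - 2 * (y \<bullet> y)) * (y \<bullet> h) * (2 * max 0 (s y)))) (at y)" for y
    unfolding \<phi>_def[abs_def] by (rule has_derivative_compose[OF s q])
  define Y where "Y y = \<phi> y *\<^sub>R rad y *\<^sub>R tang y" for y
  have small: "Y y = 0" if "y \<in> ball 0 1" for y
  proof -
    have "y \<bullet> y < 1" using that by (simp add: dot_square_norm abs_square_less_1)
    then have "s y \<le> 0" unfolding s_def by (intro mult_nonpos_nonneg) auto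
    then show ?thesis by (simp add: Y_def \<phi>_def q_def)
  qed
  have C1_Y: "Ck_on (Suc 0) Y UNIV"
  proof (rule Ck_on_local)
    fix y :: "real^3"
    show "\<exists>N. open N \<and> y \<in> N \<and> Ck_on (Suc 0) Y N"
    proof (cases "y = 0")
      case True
      have "Ck_on (Suc 0) Y (ball 0 1)"
        by (rule Ck_on_cong[OF open_ball _ Ck_on_const[OF open_ball, of "Suc 0" 0]]) (simp add: small)
      with True show ?thesis by (intro exI[of _ "ball 0 1"]) auto
    next
      case False
      have "Ck_on (Suc 0) Y (- {0})"
        unfolding Y_def[abs_def]
        by (rule Ck_on_scaleR[OF open_punctured Ck_on_subset[OF C1_\<phi> subset_UNIV] C1_rad_tang])
      with False open_punctured show ?thesis by (intro exI[of _ "- {0}"]) auto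
    qed
  qed
  have div_Y: "divergence Y y = \<phi> y * ((1 - \<alpha>) * (tang y \<bullet> tang y) - (2 - \<alpha>) * ((rad y)\<^sup>2 * norm y powr - 2))"
    if "y \<noteq> 0" for y
  proof -
    have "(\<lambda>y. rad y *\<^sub>R tang y) differentiable (at y)" using C1_rad_tang that by simp
    from divergence_scaleR[OF \<phi> this] show ?thesis
      using that
      by (simp add: Y_def[abs_def] divergence_rad_tang inner_commute[of y "tang y"] tang_orthogonal)
  qed
  have "divergence Y y \<le> 0" for y
  proof (cases "y = 0")
    case True
    have "divergence (\<lambda>y. 0) y = divergence Y y"
      by (rule divergence_cong[OF open_ball[of 0 1]]) (auto simp: True small)
    then show ?thesis by (simp add: divergence_def partial_def)
  next
    case False
    have "(1 - \<alpha>) * (tang y \<bullet> tang y) \<le> 0" using \<alpha> by (intro mult_nonpos_nonneg) auto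
    moreover have "(2 - \<alpha>) * ((rad y)\<^sup>2 * norm y powr - 2) \<ge> 0" using \<alpha> by simp
    ultimately show ?thesis
      unfolding div_Y[OF False] using \<phi>_nonneg by (intro mult_nonneg_nonpos) auto
  qed
  moreover have "Y y = 0" if "norm y \<ge> 2" for y
  proof -
    have "y \<bullet> y \<ge> 4" using power_mono[OF that, of 2] by (simp add: dot_square_norm)
    then have "s y \<le> 0" unfolding s_def by (intro mult_nonneg_nonpos) auto
    then show ?thesis by (simp add: Y_def \<phi>_def q_def)
  qed
  ultimately have div_0: "divergence Y y = 0" for y
    by (intro compactly_supported_divergence_nonpos[OF C1_Y]) auto
  \<comment> \<open>Rescaling moves \<open>x\<close> to radius 3/2, inside the shell where
    \<open>\<phi>\<close> is positive; homogeneity carries the conclusion back to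
    \<open>x\<close>.\<close>
  define t where "t = 3 / (2 * norm x)"
  define y where "y = t *\<^sub>R x"
  have t: "0 < t" and ny: "norm y = 3 / 2"
    using \<open>x \<noteq> 0\<close> by (auto simp: t_def y_def)
  then have y0: "y \<noteq> 0" by auto
  have "y \<bullet> y = 9 / 4" unfolding dot_square_norm ny by (simp add: power2_eq_square)
  then have "\<phi> y > 0" by (simp add: \<phi>_def q_def s_def)
  then have "(1 - \<alpha>) * (tang y \<bullet> tang y) - (2 - \<alpha>) * ((rad y)\<^sup>2 * norm y powr - 2) = 0"
    using div_0[of y] div_Y[OF y0] by simp
  then have "(\<alpha> - 1) * (tang y \<bullet> tang y) + (2 - \<alpha>) * ((rad y)\<^sup>2 * norm y powr - 2) = 0"
    by (simp add: algebra_simps)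
  then have "(\<alpha> - 1) * (tang y \<bullet> tang y) = 0"
    using \<alpha> by (subst (asm) add_nonneg_eq_0_iff) auto
  then have "tang y = 0" using \<alpha> by simp
  then have "V y = (rad y * norm y powr - 2) *\<^sub>R y" by (simp add: tang_def)
  from rad_curl_rad_eq_0_of_parallel[OF y0 this] show ?thesis
    using t \<open>x \<noteq> 0\<close> by (auto simp: y_def rad_homogeneous rad_curl_homogeneous)
qed

lemma irrotational:
  assumes "\<alpha> \<le> 2"
  shows "irrotational V"
  unfolding irrotational_def
proof (intro allI impI, rule ccontr)
  fix x :: "real^3" assume "x \<noteq> 0" "curl V x \<noteq> 0"
  define N where "N = (- {0}) \<inter> curl V -` (- {0})"
  have N: "open N" unfolding N_def
    by (intro continuous_open_preimage Ck_on_imp_continuous_on[OF C1_curl] open_punctured)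
  have "x \<in> N" using \<open>x \<noteq> 0\<close> \<open>curl V x \<noteq> 0\<close> by (simp add: N_def)
  have rad_0: "rad y = 0" if "y \<in> N" for y
  proof -
    have y: "y \<noteq> 0" "curl V y \<noteq> 0" using that by (auto simp: N_def)
    have "rad_curl y * rad y = 0"
      using rad_curl_rad_eq_0_le_1[OF _ y(1)] rad_curl_rad_eq_0_gt_1[OF _ _ y(1)] assms by linarith
    then show ?thesis using rad_scaleR_curl[OF y(1)] y(2) by auto
  qed
  have V_0: "V y = 0" if "y \<in> N" for y
  proof -
    have y: "y \<noteq> 0" "curl V y \<noteq> 0" using that by (auto simp: N_def)
    have "((\<lambda>y. 0) has_derivative (\<lambda>h. ((1 - \<alpha>) *\<^sub>R V y + y \<times> curl V y) \<bullet> h)) (at y)"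
      by (rule has_derivative_transform_within_open[OF rad_has_derivative[OF y(1)] N that rad_0])
    from has_derivative_unique[OF this has_derivative_const]
    have grad: "((1 - \<alpha>) *\<^sub>R V y + y \<times> curl V y) \<bullet> h = 0" for h by metis
    show ?thesis
    proof (cases "\<alpha> = 1")
      case False
      then show ?thesis using grad[of "V y"] unfolding grad_rad_inner_V[OF y(1)] by simp
    next
      \<comment> \<open>For \<open>\<alpha> = 1\<close> the gradient no longer contains
        \<open>V\<close>. It shows instead that the nonzero curl is parallel to \<open>y\<close>, so
        \<open>rad_curl y\<close> is nonzero and \<open>rad_scaleR_curl\<close> gives
        \<open>V y = 0\<close>.\<close>
      case True
      then have "y \<times> curl V y = 0" using grad[of "y \<times> curl V y"] by simp
      then have "rad_curl y \<noteq> 0"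
        using norm_and_cross_eq_0[of y "curl V y"] y by (auto simp: rad_curl_def)
      then show ?thesis using rad_scaleR_curl[OF y(1)] rad_0[OF that] by simp
    qed
  qed
  have "partial i V x = 0" for i
    using frechet_derivative_transform_within_open[OF differentiable[OF \<open>x \<noteq> 0\<close>] N \<open>x \<in> N\<close> V_0]
    by (simp add: partial_def)
  then show False using \<open>curl V x \<noteq> 0\<close> by (simp add: curl_eq_sum_cross)
qed

end

section \<open>Homogeneous Euler flows\<close>

text \<open>Constancy gives \<open>gradient P x \<bullet> h = - (DV h \<bullet> V x)\<close>.
  Inserted into the Euler equation, this leaves the antisymmetric part of the Jacobian applied to
  \<open>V x\<close>, which is the cross product with the curl.\<close>

lemma curl_cross_eq_0_of_bernoulli_const:
  assumes "open U" "x \<in> U" and V: "\<And>y. y \<in> U \<Longrightarrow> V differentiable (at y)"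
    and P: "\<And>y. y \<in> U \<Longrightarrow> V y \<bullet> V y + 2 * P y = c"
    and euler: "convective V V x + gradient P x = 0"
  shows "curl V x \<times> V x = 0"
proof -
  let ?D = "frechet_derivative V (at x)"
  have D: "(V has_derivative ?D) (at x)"
    using V assms(2) frechet_derivative_works by blast
  \<comment> \<open>The derivative of \<open>P\<close> is read off from this expression, which
    equals \<open>P\<close> on \<open>U\<close>.\<close>
  have "((\<lambda>y. (c - V y \<bullet> V y) / 2) has_derivative (\<lambda>h. - (?D h \<bullet> V x))) (at x)"
    by (rule derivative_eq_intros D refl | simp add: inner_commute)+
  then have "(P has_derivative (\<lambda>h. - (?D h \<bullet> V x))) (at x)"
    by (rule has_derivative_transform_within_open[OF _ assms(1,2)]) (use P in \<open>simp add: field_simps\<close>)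
  then have grad: "gradient P x \<bullet> h = - (?D h \<bullet> V x)" for h
    using gradient_inner[of P x h] by (simp add: differentiableI flip: frechet_derivative_at)
  have "(curl V x \<times> V x) \<bullet> h = 0" for h
  proof -
    have "(convective V V x + gradient P x) \<bullet> h = 0" using euler by simp
    then show ?thesis
      using curl_antisymmetric[OF V[OF assms(2)], of "V x" h]
      by (simp add: inner_add_left grad convective_eq[OF V[OF assms(2)]])
  qed
  then show ?thesis by (metis inner_eq_zero_iff)
qed

lemma hom_velocity_scaleR:
  "0 < t \<Longrightarrow> hom_velocity \<alpha> v f (t *\<^sub>R x) = t powr - \<alpha> *\<^sub>R hom_velocity \<alpha> v f x"
  by (simp add: hom_velocity_def sgn_scaleR powr_mult powr_minus)

lemma bernoulli_hom:
  assumes "x \<noteq> 0" "v (sgn x) \<bullet> sgn x = 0"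
  shows "hom_velocity \<alpha> v f x \<bullet> hom_velocity \<alpha> v f x + 2 * hom_pressure \<alpha> p x =
    bernoulli v f p (sgn x) / norm x powr (2 * \<alpha>)"
proof -
  define w where "w = v (sgn x) + f (sgn x) *\<^sub>R sgn x"
  have "w \<bullet> w = (norm (v (sgn x)))\<^sup>2 + (f (sgn x))\<^sup>2 * (norm (sgn x))\<^sup>2"
    using assms(2)
    by (simp add: w_def inner_add_left inner_add_right inner_commute[of "sgn x" "v (sgn x)"]
        dot_square_norm[of "sgn x"] dot_square_norm[of "v (sgn x)"] power2_eq_square[of "f _"])
  then have "w \<bullet> w = (norm (v (sgn x)))\<^sup>2 + (f (sgn x))\<^sup>2"
    using assms(1) by (simp add: norm_sgn)
  moreover have "norm x powr (2 * \<alpha>) = norm x powr \<alpha> * norm x powr \<alpha>"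
    by (simp flip: powr_add)
  moreover have "hom_velocity \<alpha> v f x = w /\<^sub>R norm x powr \<alpha>"
    by (simp add: hom_velocity_def w_def)
  ultimately show ?thesis
    by (simp add: hom_pressure_def bernoulli_def divide_inverse distrib_left distrib_right mult_ac)
qed

text \<open>The common form of both claims: the quotient is constant in space either because H is
  zero or because \<alpha> is zero and H is constant.\<close>

lemma irrotational_of_bernoulli:
  assumes sol: "Ck_solution 2 \<alpha> v f p" and "\<alpha> \<le> 2"
    and c: "\<And>x. x \<noteq> 0 \<Longrightarrow> bernoulli v f p (sgn x) / norm x powr (2 * \<alpha>) = c"
  shows "irrotational (hom_velocity \<alpha> v f)"
proof -
  let ?V = "hom_velocity \<alpha> v f"
  have C2: "Ck_on (Suc (Suc 0)) ?V (- {0})"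
    using sol by (intro Ck_on_hom_velocity) (simp_all add: Ck_solution_def numeral_2_eq_2)
  have "curl ?V x \<times> ?V x = 0" if "x \<noteq> 0" for x
  proof (rule curl_cross_eq_0_of_bernoulli_const[of "- {0}"])
    show "?V y \<bullet> ?V y + 2 * hom_pressure \<alpha> p y = c" if "y \<in> - {0}" for y
    proof -
      have "v (sgn y) \<bullet> sgn y = 0" using sol that by (simp add: Ck_solution_def norm_sgn)
      then show ?thesis using bernoulli_hom c that by simp
    qed
  qed (use C2 sol that in \<open>auto simp: Ck_solution_def\<close>)
  then interpret homogeneous_beltrami_field \<alpha> ?V
    using C2 sol by unfold_locales (auto simp: hom_velocity_scaleR Ck_solution_def)
  show ?thesis using irrotational \<open>\<alpha> \<le> 2\<close> .
qed

theorem proposition3p2: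
  fixes \<alpha> :: real
    and v :: "real^3 \<Rightarrow> real^3"
    and f p :: "real^3 \<Rightarrow> real"
  assumes "Ck_solution 2 \<alpha> v f p"
  shows "(\<alpha> \<le> 2 \<and> (\<forall>x\<in>S2. bernoulli v f p x = 0)
            \<longrightarrow> irrotational (hom_velocity \<alpha> v f)) \<and>
         (\<alpha> = 0 \<and> (\<exists>c. \<forall>x\<in>S2. bernoulli v f p x = c)
            \<longrightarrow> irrotational (hom_velocity \<alpha> v f))"
proof (intro conjI impI; elim conjE exE)
  assume "\<alpha> \<le> 2" "\<forall>x\<in>S2. bernoulli v f p x = 0"
  then show "irrotational (hom_velocity \<alpha> v f)"
    by (intro irrotational_of_bernoulli[OF assms, of 0]) (auto simp: norm_sgn)
next
  fix c assume "\<alpha> = 0" "\<forall>x\<in>S2. bernoulli v f p x = c"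
  then show "irrotational (hom_velocity \<alpha> v f)"
    by (intro irrotational_of_bernoulli[OF assms, of c]) (auto simp: norm_sgn)
qed

end
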